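(* Let $(\mathfrak h,h)$ be a Lie algebra with an inner product, $\xi\in\mathfrak h^*$ a non-zero closed 1-form, $q\ge1$, and $\beta:\mathfrak h\to\mathfrak{so}(\mathbb R^q)$ an orthogonal Lie algebra representation, where $\mathbb R^q$ carries the canonical inner product $\langle\cdot,\cdot\rangle_{\mathbb R^q}$. Let $\alpha:\mathfrak h\to\mathfrak{gl}(\mathbb R^q)$ be the representation $\alpha(x)=\xi(x)\mathrm{Id}+\beta(x)$, let $\mathfrak g:=\mathfrak h\ltimes_\alpha\mathbb R^q$, $g:=h+\langle\cdot,\cdot\rangle_{\mathbb R^q}$ (orthogonal sum), let $\theta\in\mathfrak g^*$ be the extension of $\xi$ by zero on $\mathbb R^q$, and let $\mathfrak u:=\mathbb R^q\subset\mathfrak g$. Then $(g,\theta,\mathfrak u)$ is an adapted LCP structure on $\mathfrak g$. Moreover, $\mathfrak g$ is solvable if and only if $\mathfrak h$ is solvable, and $\mathfrak g$ is unimodular if and only if $\xi=-\frac1q H^{\mathfrak h}$.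
   Context: All Lie algebras are real and finite-dimensional; $\mathbb R^q$ is regarded as an abelian Lie algebra. The trace form of a Lie algebra $\mathfrak h$ is $H^{\mathfrak h}(x)=\mathrm{tr}(\mathrm{ad}_x)$, $x\in\mathfrak h$; $\mathfrak h$ is unimodular if $H^{\mathfrak h}=0$. Let $\mathfrak g$ be a Lie algebra with an inner product $g$. For $x\in\mathfrak g$, $\nabla^g_x\in\mathfrak{so}(\mathfrak g)$ is given by $g(\nabla^g_xy,z)=\frac12\big(g([x,y],z)-g([x,z],y)-g([y,z],x)\big)$. For $\theta\in\mathfrak g^*$ with $g$-dual vector $\theta^\sharp$, set $\nabla^\theta_xy:=\nabla^g_xy+\theta(x)y+\theta(y)x-g(x,y)\theta^\sharp$. A 1-form on a Lie algebra is closed if it vanishes on the derived algebra. A subspace $\mathfrak u\subset\mathfrak g$ is $\nabla^\theta$-flat if $\nabla^\theta_x\mathfrak u\subset\mathfrak u$ for all $x\in\mathfrak g$ and $x\mapsto\nabla^\theta_x|_{\mathfrak u}$ is a Lie algebra representation $\mathfrak g\to\mathfrak{gl}(\mathfrak u)$. An LCP structure on $\mathfrak g$ is a triple $(g,\theta,\mathfrak u)$ with $g$ an inner product, $\theta\ne0$ a closed 1-form and $\mathfrak u\neq0$ a $\nabla^\theta$-flat subspace. It is adapted if $\theta|_{\mathfrak u}=0$. *)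

theory Defs
  imports "HOL-Analysis.Analysis"
begin

text \<open>
  The class \<^class>\<open>euclidean_space\<close> only provides finite-dimensionality. The inner product
  of a Lie algebra is always an explicit bilinear form, unrelated to the inner product of the
  class; the latter is used only on \<open>real ^ 'q\<close>, where it is the canonical one, and in the formula
  for the (basis-independent) trace.
\<close>

locale lie_algebra =
  fixes br :: "'a::euclidean_space \<Rightarrow> 'a \<Rightarrow> 'a"
  assumes bilinear_br: "bilinear br"
    and br_self: "br x x = 0"
    and jacobi: "br x (br y z) + br y (br z x) + br z (br x y) = 0"

definition brackets :: "('a::euclidean_space \<Rightarrow> 'a \<Rightarrow> 'a) \<Rightarrow> 'a set \<Rightarrow> 'a set \<Rightarrow> 'a set" where
  "brackets br A B = span {br x y |x y. x \<in> A \<and> y \<in> B}"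

primrec derived_series :: "('a::euclidean_space \<Rightarrow> 'a \<Rightarrow> 'a) \<Rightarrow> nat \<Rightarrow> 'a set" where
  "derived_series br 0 = UNIV"
| "derived_series br (Suc n) = brackets br (derived_series br n) (derived_series br n)"

definition lie_solvable :: "('a::euclidean_space \<Rightarrow> 'a \<Rightarrow> 'a) \<Rightarrow> bool" where
  "lie_solvable br \<longleftrightarrow> (\<exists>n. derived_series br n = {0})"

definition endo_trace :: "('a::euclidean_space \<Rightarrow> 'a) \<Rightarrow> real" where
  "endo_trace f = (\<Sum>b\<in>Basis. f b \<bullet> b)"

definition trace_form :: "('a::euclidean_space \<Rightarrow> 'a \<Rightarrow> 'a) \<Rightarrow> 'a \<Rightarrow> real" where
  "trace_form br x = endo_trace (br x)"

definition unimodular :: "('a::euclidean_space \<Rightarrow> 'a \<Rightarrow> 'a) \<Rightarrow> bool" where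
  "unimodular br \<longleftrightarrow> trace_form br = (\<lambda>x. 0)"

definition closed_form :: "('a::euclidean_space \<Rightarrow> 'a \<Rightarrow> 'a) \<Rightarrow> ('a \<Rightarrow> real) \<Rightarrow> bool" where
  "closed_form br \<theta> \<longleftrightarrow> linear \<theta> \<and> (\<forall>x\<in>brackets br UNIV UNIV. \<theta> x = 0)"

text \<open>
  The map \<open>x \<mapsto> \<rho> x\<close>, restricted to \<open>V\<close>, is a Lie algebra homomorphism into \<open>gl(V)\<close>; the values
  of \<open>\<rho> x\<close> outside \<open>V\<close> are irrelevant.
\<close>

definition lie_representation_on ::
  "('a::euclidean_space \<Rightarrow> 'a \<Rightarrow> 'a) \<Rightarrow> 'b::euclidean_space set \<Rightarrow> ('a \<Rightarrow> 'b \<Rightarrow> 'b) \<Rightarrow> bool" where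
  "lie_representation_on br V \<rho> \<longleftrightarrow>
     subspace V \<and>
     (\<forall>x. \<forall>v\<in>V. \<rho> x v \<in> V) \<and>
     (\<forall>x. \<forall>v\<in>V. \<forall>w\<in>V. \<rho> x (v + w) = \<rho> x v + \<rho> x w) \<and>
     (\<forall>x. \<forall>v\<in>V. \<forall>c. \<rho> x (c *\<^sub>R v) = c *\<^sub>R \<rho> x v) \<and>
     (\<forall>v\<in>V. linear (\<lambda>x. \<rho> x v)) \<and>
     (\<forall>x y. \<forall>v\<in>V. \<rho> (br x y) v = \<rho> x (\<rho> y v) - \<rho> y (\<rho> x v))"

definition inner_product :: "('a::euclidean_space \<Rightarrow> 'a \<Rightarrow> real) \<Rightarrow> bool" where
  "inner_product g \<longleftrightarrow> bilinear g \<and> (\<forall>x y. g x y = g y x) \<and> (\<forall>x. x \<noteq> 0 \<longrightarrow> g x x > 0)"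

definition so_endo :: "('a::euclidean_space \<Rightarrow> 'a \<Rightarrow> real) \<Rightarrow> ('a \<Rightarrow> 'a) set" where
  "so_endo g = {f. linear f \<and> (\<forall>x y. g (f x) y = - g x (f y))}"

definition sharp :: "('a::euclidean_space \<Rightarrow> 'a \<Rightarrow> real) \<Rightarrow> ('a \<Rightarrow> real) \<Rightarrow> 'a" where
  "sharp g \<theta> = (THE t. \<forall>y. g t y = \<theta> y)"

definition levi_civita ::
  "('a::euclidean_space \<Rightarrow> 'a \<Rightarrow> 'a) \<Rightarrow> ('a \<Rightarrow> 'a \<Rightarrow> real) \<Rightarrow> 'a \<Rightarrow> 'a \<Rightarrow> 'a" where
  "levi_civita br g x y =
     (THE w. \<forall>z. g w z = 1/2 * (g (br x y) z - g (br x z) y - g (br y z) x))"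

definition weyl_connection ::
  "('a::euclidean_space \<Rightarrow> 'a \<Rightarrow> 'a) \<Rightarrow> ('a \<Rightarrow> 'a \<Rightarrow> real) \<Rightarrow> ('a \<Rightarrow> real) \<Rightarrow> 'a \<Rightarrow> 'a \<Rightarrow> 'a" where
  "weyl_connection br g \<theta> x y =
     levi_civita br g x y + \<theta> x *\<^sub>R y + \<theta> y *\<^sub>R x - g x y *\<^sub>R sharp g \<theta>"

lemma inner_product_riesz:
  fixes g :: "'a::euclidean_space \<Rightarrow> 'a \<Rightarrow> real"
  assumes g: "inner_product g" and f: "linear f"
  shows "\<exists>!t. \<forall>y. g t y = f y"
proof -
  define T where "T t = (\<Sum>b\<in>Basis. g t b *\<^sub>R b)" for t
  have bil: "bilinear g" and pos: "\<And>x. x \<noteq> 0 \<Longrightarrow> g x x > 0"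
    using g by (auto simp: inner_product_def)
  have lin: "linear (\<lambda>t. g t y)" "linear (g t)" for y t
    using bil by (auto simp: bilinear_def)
  have TB: "T t \<bullet> b = g t b" if "b \<in> Basis" for t b
    using that by (simp add: T_def)
  have expand: "\<phi> y = (\<Sum>b\<in>Basis. (y \<bullet> b) * \<phi> b)" if "linear \<phi>" for \<phi> :: "'a \<Rightarrow> real" and y
  proof -
    have "\<phi> y = \<phi> (\<Sum>b\<in>Basis. (y \<bullet> b) *\<^sub>R b)"
      by (simp add: euclidean_representation)
    also have "\<dots> = (\<Sum>b\<in>Basis. (y \<bullet> b) * \<phi> b)"
      using that by (simp add: linear_sum linear_scale)
    finally show ?thesis .
  qed
  have gT: "g t y = T t \<bullet> y" for t y
    unfolding expand[OF lin(2), of t y] T_def inner_sum_left inner_scaleR_left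
    by (intro sum.cong refl) (simp add: inner_commute)
  have "linear T"
  proof (rule linearI)
    show "T (s + t) = T s + T t" for s t
      by (simp add: T_def linear_add[OF lin(1)] scaleR_add_left sum.distrib)
    show "T (c *\<^sub>R t) = c *\<^sub>R T t" for c t
      by (simp add: T_def linear_scale[OF lin(1)] scaleR_sum_right)
  qed
  have zero: "t = 0" if "T t = 0" for t
    using pos[of t] gT[of t t] that by (cases "t = 0") auto
  hence inj: "inj T"
    using linear_injective_0[OF \<open>linear T\<close>] zero by simp
  have "surj T"
    by (rule linear_injective_imp_surjective[OF \<open>linear T\<close> inj refl])
  then obtain t where t: "(\<Sum>b\<in>Basis. f b *\<^sub>R b) = T t"
    by (rule surjE)
  hence "g t y = f y" for y
    unfolding gT expand[OF f, of y] t[symmetric] inner_sum_left inner_scaleR_left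
    by (intro sum.cong refl) (simp add: inner_commute)
  moreover have "s = t" if "\<forall>y. g s y = f y" "\<forall>y. g t y = f y" for s t
  proof -
    have "T s = T t"
      by (rule euclidean_eqI) (simp only: TB that[rule_format])
    with inj show ?thesis by (rule injD)
  qed
  ultimately show ?thesis by blast
qed

lemma sharp_eq:
  assumes "inner_product g" "linear \<theta>"
  shows "g (sharp g \<theta>) y = \<theta> y"
  using theI'[OF inner_product_riesz[OF assms]] by (simp add: sharp_def)

lemma levi_civita_eq:
  assumes "lie_algebra br" "inner_product g"
  shows "g (levi_civita br g x y) z = 1/2 * (g (br x y) z - g (br x z) y - g (br y z) x)"
proof -
  have b: "bilinear br" and g: "bilinear g"
    using assms by (auto simp: lie_algebra_def inner_product_def)
  have "linear (\<lambda>z. g (br a z) c)" for a c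
    using linear_compose[of "br a" "\<lambda>w. g w c"] b g by (simp add: bilinear_def o_def)
  moreover have "linear (g (br x y))"
    using g by (simp add: bilinear_def)
  ultimately have "linear (\<lambda>z. g (br x y) z - g (br x z) y - g (br y z) x)"
    by (intro linear_compose_sub)
  from linear_compose_scale_right[OF this, of "1/2"]
  have "linear (\<lambda>z. 1/2 * (g (br x y) z - g (br x z) y - g (br y z) x))"
    by (simp only: real_scaleR_def)
  from theI'[OF inner_product_riesz[OF assms(2) this]] show ?thesis
    by (simp add: levi_civita_def)
qed

definition flat_subspace ::
  "('a::euclidean_space \<Rightarrow> 'a \<Rightarrow> 'a) \<Rightarrow> ('a \<Rightarrow> 'a \<Rightarrow> real) \<Rightarrow> ('a \<Rightarrow> real) \<Rightarrow> 'a set \<Rightarrow> bool" where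
  "flat_subspace br g \<theta> u \<longleftrightarrow>
     subspace u \<and>
     (\<forall>x. weyl_connection br g \<theta> x ` u \<subseteq> u) \<and>
     lie_representation_on br u (weyl_connection br g \<theta>)"

definition lcp_structure ::
  "('a::euclidean_space \<Rightarrow> 'a \<Rightarrow> 'a) \<Rightarrow> ('a \<Rightarrow> 'a \<Rightarrow> real) \<Rightarrow> ('a \<Rightarrow> real) \<Rightarrow> 'a set \<Rightarrow> bool" where
  "lcp_structure br g \<theta> u \<longleftrightarrow>
     lie_algebra br \<and> inner_product g \<and>
     closed_form br \<theta> \<and> \<theta> \<noteq> (\<lambda>x. 0) \<and>
     flat_subspace br g \<theta> u \<and> u \<noteq> {0}"

definition adapted_lcp_structure ::
  "('a::euclidean_space \<Rightarrow> 'a \<Rightarrow> 'a) \<Rightarrow> ('a \<Rightarrow> 'a \<Rightarrow> real) \<Rightarrow> ('a \<Rightarrow> real) \<Rightarrow> 'a set \<Rightarrow> bool" where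
  "adapted_lcp_structure br g \<theta> u \<longleftrightarrow> lcp_structure br g \<theta> u \<and> (\<forall>x\<in>u. \<theta> x = 0)"

definition twisted_rep :: "('a \<Rightarrow> real) \<Rightarrow> ('a \<Rightarrow> 'b \<Rightarrow> 'b) \<Rightarrow> 'a \<Rightarrow> 'b \<Rightarrow> 'b::real_vector" where
  "twisted_rep \<xi> \<beta> x v = \<xi> x *\<^sub>R v + \<beta> x v"

definition semidirect_bracket ::
  "('a \<Rightarrow> 'a \<Rightarrow> 'a) \<Rightarrow> ('a \<Rightarrow> 'b \<Rightarrow> 'b) \<Rightarrow> 'a \<times> 'b \<Rightarrow> 'a \<times> 'b \<Rightarrow> 'a \<times> 'b::real_vector" where
  "semidirect_bracket br \<alpha> = (\<lambda>(x, v) (y, w). (br x y, \<alpha> x w - \<alpha> y v))"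

definition orthogonal_sum ::
  "('a \<Rightarrow> 'a \<Rightarrow> real) \<Rightarrow> ('b \<Rightarrow> 'b \<Rightarrow> real) \<Rightarrow> 'a \<times> 'b \<Rightarrow> 'a \<times> 'b \<Rightarrow> real" where
  "orthogonal_sum h k = (\<lambda>(x, v) (y, w). h x y + k v w)"

definition extend_by_zero :: "('a \<Rightarrow> real) \<Rightarrow> 'a \<times> 'b \<Rightarrow> real" where
  "extend_by_zero \<xi> = (\<lambda>(x, v). \<xi> x)"

lemma lie_representation_twisted_rep:
  assumes \<xi>: "closed_form br \<xi>" and \<beta>: "lie_representation_on br UNIV \<beta>"
  shows "lie_representation_on br UNIV (twisted_rep \<xi> \<beta>)"
proof -
  have lin: "linear \<xi>" and zero: "\<xi> (br x y) = 0" for x y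
    using \<xi> by (auto simp: closed_form_def brackets_def intro: span_base)
  have "linear (\<lambda>x. twisted_rep \<xi> \<beta> x v)" for v
  proof -
    have "linear (\<lambda>x. \<beta> x v)"
      using \<beta> by (simp add: lie_representation_on_def)
    moreover have "linear (\<lambda>x. \<xi> x *\<^sub>R v)"
      by (rule linearI) (simp_all add: linear_add[OF lin] linear_scale[OF lin] scaleR_add_left)
    ultimately show ?thesis
      unfolding twisted_rep_def by (intro linear_compose_add)
  qed
  thus ?thesis
    using \<beta> by (simp add: lie_representation_on_def twisted_rep_def zero algebra_simps)
qed

end

theory Submission
  imports Defs
begin

text \<open>
  On \<open>\<real>\<^sup>q\<close> the Weyl connection is the given representation: in the Levi-Civita term of \<open>(x, a)\<close> and
  \<open>(0, v)\<close> the orthogonal part \<open>\<beta>\<close> survives and the conformal part \<open>\<xi>\<close> produces the vector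
  \<open>\<langle>a, v\<rangle> \<theta>\<^sup>\<sharp>\<close>, which the Weyl correction cancels, while its other term restores \<open>\<xi>(x) v\<close>. Hence
  \<open>\<nabla>\<^sup>\<theta>\<close> maps \<open>(x, a)\<close>, \<open>(0, v)\<close> to \<open>(0, \<alpha>(x) v)\<close>, and flatness says that \<open>\<alpha>\<close> is a representation.
  Solvability passes through the extension by the abelian ideal \<open>\<real>\<^sup>q\<close>, and the trace form of the
  semidirect product at \<open>(x, v)\<close> is \<open>H(x) + tr \<alpha>(x) = H(x) + q \<xi>(x)\<close>.
\<close>

section \<open>Bracket, metric and closed form on the semidirect product\<close>

lemma semidirect_bracket_simp [simp]:
  "semidirect_bracket br \<alpha> (x, v) (y, w) = (br x y, \<alpha> x w - \<alpha> y v)"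
  by (simp add: semidirect_bracket_def)

lemma orthogonal_sum_simp [simp]: "orthogonal_sum h k (x, v) (y, w) = h x y + k v w"
  by (simp add: orthogonal_sum_def)

lemma extend_by_zero_simp [simp]: "extend_by_zero \<xi> (x, v) = \<xi> x"
  by (simp add: extend_by_zero_def)

lemma lie_representation_onD:
  assumes "lie_representation_on br UNIV \<alpha>"
  shows "linear (\<alpha> x)" "linear (\<lambda>x. \<alpha> x v)" "\<alpha> (br x y) v = \<alpha> x (\<alpha> y v) - \<alpha> y (\<alpha> x v)"
  using assms by (auto simp: lie_representation_on_def intro: linearI)

text \<open>The first component of the Jacobi identity is that of \<open>br\<close>; in the second,
  the terms cancel because \<alpha> turns brackets into commutators.\<close>

lemma lie_algebra_semidirect_bracket:
  assumes "lie_algebra br" and \<alpha>: "lie_representation_on br UNIV \<alpha>"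
  shows "lie_algebra (semidirect_bracket br \<alpha>)"
proof -
  interpret lie_algebra br by fact
  note lin = lie_representation_onD(1,2)[OF \<alpha>]
  note rules = bilinear_ladd[OF bilinear_br] bilinear_radd[OF bilinear_br]
    bilinear_lmul[OF bilinear_br] bilinear_rmul[OF bilinear_br]
    linear_add[OF lin(1)] linear_scale[OF lin(1)] linear_diff[OF lin(1)]
    linear_add[OF lin(2)] linear_scale[OF lin(2)]
  show ?thesis
  proof
    show "bilinear (semidirect_bracket br \<alpha>)"
      unfolding bilinear_def
      by (auto intro!: linearI simp: rules algebra_simps)
    show "semidirect_bracket br \<alpha> X X = 0" for X
      by (cases X) (simp add: br_self zero_prod_def)
    show "semidirect_bracket br \<alpha> X (semidirect_bracket br \<alpha> Y Z)
        + semidirect_bracket br \<alpha> Y (semidirect_bracket br \<alpha> Z X)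
        + semidirect_bracket br \<alpha> Z (semidirect_bracket br \<alpha> X Y) = 0" for X Y Z
      by (cases X; cases Y; cases Z)
        (simp add: jacobi rules lie_representation_onD(3)[OF \<alpha>] zero_prod_def)
  qed
qed

lemma inner_product_inner: "inner_product (\<bullet>)"
  by (auto simp: inner_product_def inner_commute bilinear_conv_bounded_bilinear
      bounded_bilinear_inner)

lemma inner_product_orthogonal_sum:
  assumes "inner_product h" "inner_product k"
  shows "inner_product (orthogonal_sum h k)"
proof -
  have h: "bilinear h" and k: "bilinear k"
    using assms by (auto simp: inner_product_def)
  note rules = bilinear_ladd[OF h] bilinear_radd[OF h] bilinear_lmul[OF h] bilinear_rmul[OF h]
    bilinear_ladd[OF k] bilinear_radd[OF k] bilinear_lmul[OF k] bilinear_rmul[OF k]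
  have "bilinear (orthogonal_sum h k)"
    unfolding bilinear_def
    by (auto intro!: linearI simp: rules algebra_simps)
  moreover have "orthogonal_sum h k X Y = orthogonal_sum h k Y X" for X Y
    using assms by (cases X; cases Y) (simp add: inner_product_def)
  moreover have "orthogonal_sum h k X X > 0" if "X \<noteq> 0" for X
  proof -
    obtain x v where X: "X = (x, v)" by (cases X)
    have "h x x \<ge> 0" "k v v \<ge> 0"
      using assms bilinear_lzero[OF h] bilinear_lzero[OF k]
      by (metis inner_product_def order_le_less)+
    moreover have "h x x > 0 \<or> k v v > 0"
      using assms that by (auto simp: X inner_product_def zero_prod_def)
    ultimately show ?thesis by (auto simp: X)
  qed
  ultimately show ?thesis by (simp add: inner_product_def)
qed

text \<open>The uniqueness half of the Riesz lemma. Since \<open>levi_civita\<close> and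
  \<open>sharp\<close> are known only through their pairings, identities between vectors are checked
  by pairing with an arbitrary \<open>z\<close>.\<close>

lemma inner_product_eqI:
  assumes "inner_product g" "\<And>z. g x z = g y z"
  shows "x = y"
proof -
  have "linear (g y)" using assms(1) by (simp add: inner_product_def bilinear_def)
  thus ?thesis
    using inner_product_riesz[OF assms(1)] assms(2) by blast
qed

lemma linear_extend_by_zero:
  assumes "linear \<xi>"
  shows "linear (extend_by_zero \<xi>)"
  by (auto intro!: linearI simp: linear_add[OF assms] linear_scale[OF assms])

lemma closed_form_iff: "closed_form br \<theta> \<longleftrightarrow> linear \<theta> \<and> (\<forall>x y. \<theta> (br x y) = 0)"
proof -
  have "\<theta> x = 0" if "linear \<theta>" "\<forall>x y. \<theta> (br x y) = 0" "x \<in> brackets br UNIV UNIV" for x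
    using that(3) unfolding brackets_def
    by (rule linear_eq_0_on_span[OF that(1), rotated]) (use that(2) in auto)
  thus ?thesis
    unfolding closed_form_def brackets_def by (blast intro: span_base)
qed

text \<open>The extension is \<xi> after the projection to the first factor, which respects
  brackets, so it kills brackets as \<xi> does.\<close>

lemma closed_form_extend_by_zero:
  assumes "closed_form br \<xi>"
  shows "closed_form (semidirect_bracket br \<alpha>) (extend_by_zero \<xi>)"
  using assms by (simp add: closed_form_iff linear_extend_by_zero)

section \<open>The Weyl connection on the second factor\<close>

lemma weyl_connection_semidirect:
  assumes "lie_algebra br" "inner_product h" "closed_form br \<xi>"
    and \<beta>: "lie_representation_on br UNIV \<beta>" and so: "\<And>x. \<beta> x \<in> so_endo (\<bullet>)"
  shows "weyl_connection (semidirect_bracket br (twisted_rep \<xi> \<beta>)) (orthogonal_sum h (\<bullet>))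
    (extend_by_zero \<xi>) (x, a) (0, v) = (0, twisted_rep \<xi> \<beta> x v)"
    (is "weyl_connection ?br ?g ?\<theta> _ _ = _")
proof -
  have br: "lie_algebra ?br"
    using assms lie_algebra_semidirect_bracket lie_representation_twisted_rep by blast
  have g: "inner_product ?g"
    by (intro inner_product_orthogonal_sum assms inner_product_inner)
  have \<xi>: "linear \<xi>" using assms by (simp add: closed_form_def)
  note \<theta> = linear_extend_by_zero[OF \<xi>]
  have bil: "bilinear ?g" "bilinear br" "bilinear h"
    using g assms by (auto simp: inner_product_def lie_algebra_def)
  have skew: "\<beta> y v \<bullet> w = - (\<beta> y w \<bullet> v)" for y v w
  proof -
    have "\<beta> y v \<bullet> w = - (v \<bullet> \<beta> y w)"
      using so[of y] by (simp add: so_endo_def)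
    thus ?thesis by (simp only: inner_commute)
  qed
  have \<beta>0: "\<beta> 0 v = 0" for v
    using linear_0[OF lie_representation_onD(2)[OF \<beta>]] .
  show ?thesis
  proof (rule inner_product_eqI[OF g])
    fix Z :: "'a \<times> 'b"
    obtain y w where Z: "Z = (y, w)" by (cases Z)
    \<comment> \<open>The term with \<open>?\<theta> (0, v)\<close> drops out, the metric on the two
      arguments reduces to \<open>a \<bullet> v\<close>, and \<open>sharp\<close> paired with
      \<open>Z\<close> gives \<open>\<xi> y\<close>.\<close>
    have "?g (weyl_connection ?br ?g ?\<theta> (x, a) (0, v)) Z =
        ?g (levi_civita ?br ?g (x, a) (0, v)) Z + \<xi> x * (v \<bullet> w) - (a \<bullet> v) * \<xi> y"
      unfolding weyl_connection_def
      by (simp only: bilinear_ladd[OF bil(1)] bilinear_lsub[OF bil(1)] bilinear_lmul[OF bil(1)]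
          sharp_eq[OF g \<theta>])
        (simp add: Z linear_0[OF \<xi>] bilinear_lzero[OF bil(3)] bilinear_rzero[OF bil(3)])
    \<comment> \<open>In the Koszul formula the \<open>\<xi> x\<close> terms cancel by symmetry of
      the inner product and the \<open>\<beta> y\<close> terms by skewness. The two
      \<open>\<beta> x\<close> terms agree by skewness and the two \<open>\<xi> y\<close> terms by
      symmetry, which absorbs the factor 1/2.\<close>
    also have "?g (levi_civita ?br ?g (x, a) (0, v)) Z = \<beta> x v \<bullet> w + (a \<bullet> v) * \<xi> y"
      using skew[of x v w] skew[of y v a]
      by (simp add: levi_civita_eq[OF br g] Z linear_0[OF \<xi>] twisted_rep_def \<beta>0
          bilinear_lzero[OF bil(2)] bilinear_rzero[OF bil(2)]
          bilinear_lzero[OF bil(3)] bilinear_rzero[OF bil(3)] inner_commute[of v]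
          inner_add_left inner_diff_left field_simps)
    finally show "?g (weyl_connection ?br ?g ?\<theta> (x, a) (0, v)) Z
        = ?g (0, twisted_rep \<xi> \<beta> x v) Z"
      by (simp add: Z twisted_rep_def[of \<xi> \<beta> x v] inner_add_left bilinear_lzero[OF bil(3)])
  qed
qed

lemma flat_subspace_semidirect:
  assumes "lie_algebra br" "inner_product h" "closed_form br \<xi>"
    and \<beta>: "lie_representation_on br UNIV \<beta>" and so: "\<And>x. \<beta> x \<in> so_endo (\<bullet>)"
  shows "flat_subspace (semidirect_bracket br (twisted_rep \<xi> \<beta>)) (orthogonal_sum h (\<bullet>))
    (extend_by_zero \<xi>) ({0} \<times> UNIV)"
proof -
  define \<alpha> where "\<alpha> = twisted_rep \<xi> \<beta>"
  have \<alpha>: "lie_representation_on br UNIV \<alpha>"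
    unfolding \<alpha>_def by (rule lie_representation_twisted_rep) fact+
  note rep = lie_representation_onD[OF \<alpha>]
  define W where
    "W = weyl_connection (semidirect_bracket br \<alpha>) (orthogonal_sum h (\<bullet>)) (extend_by_zero \<xi>)"
  have W: "W (x, a) (0, v) = (0, \<alpha> x v)" for x a v
    unfolding W_def \<alpha>_def by (rule weyl_connection_semidirect) fact+
  have sub: "subspace ({0::'a} \<times> (UNIV :: 'b set))"
    by (intro subspace_Times) auto
  have "linear (\<lambda>X. W X (0, v))" for v
    by (auto intro!: linearI simp: W linear_add[OF rep(2)] linear_scale[OF rep(2)])
  \<comment> \<open>On the second factor \<open>W X\<close> depends only on the first component of
    \<open>X\<close>, and brackets project to \<open>br\<close>, so this is the representation
    property of \<alpha>.\<close>
  moreover have "W (semidirect_bracket br \<alpha> X Y) (0, v) = W X (W Y (0, v)) - W Y (W X (0, v))"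
    for X Y v
    by (cases X; cases Y) (simp add: W rep(3))
  ultimately have "lie_representation_on (semidirect_bracket br \<alpha>) ({0} \<times> UNIV) W"
    using sub by (auto simp: lie_representation_on_def W linear_add[OF rep(1)] linear_scale[OF rep(1)])
  thus ?thesis
    unfolding flat_subspace_def W_def[symmetric] \<alpha>_def[symmetric] using sub by (auto simp: W)
qed

section \<open>Derived series and solvability\<close>

lemma brackets_linear_image:
  assumes "linear f" "\<And>x y. f (br x y) = br' (f x) (f y)"
  shows "f ` brackets br A B = brackets br' (f ` A) (f ` B)"
proof -
  have "f ` {br x y |x y. x \<in> A \<and> y \<in> B} = {br' x y |x y. x \<in> f ` A \<and> y \<in> f ` B}"
    using assms(2) by (auto simp: image_iff) metis+
  thus ?thesis
    by (simp add: brackets_def flip: linear_span_image[OF assms(1)])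
qed

lemma derived_series_linear_image:
  assumes "linear f" "\<And>x y. f (br x y) = br' (f x) (f y)" "surj f"
  shows "f ` derived_series br n = derived_series br' n"
proof (induction n)
  case 0
  show ?case using assms(3) by simp
next
  case (Suc n)
  have "f ` brackets br A A = brackets br' (f ` A) (f ` A)" for A
    by (rule brackets_linear_image[of f br br', OF assms(1,2)])
  thus ?case by (simp add: Suc)
qed

text \<open>The projection \<open>fst\<close> is a surjective homomorphism, so it carries one
  derived series onto the other. Once the series of \<open>br\<close> is zero, that of the
  semidirect product lies in the abelian ideal of pairs \<open>(0, v)\<close> and vanishes one step
  later.\<close>

lemma lie_solvable_semidirect_bracket:
  assumes "lie_algebra br" and \<alpha>: "lie_representation_on br UNIV \<alpha>"
  shows "lie_solvable (semidirect_bracket br \<alpha>) \<longleftrightarrow> lie_solvable br"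
proof -
  let ?br = "semidirect_bracket br \<alpha>"
  have "fst (?br X Y) = br (fst X) (fst Y)" for X Y
    by (cases X; cases Y) simp
  hence fst_image: "fst ` derived_series ?br n = derived_series br n" for n
    using derived_series_linear_image[of fst ?br br n] linear_fst by simp
  have "derived_series ?br (Suc n) = {0}" if "derived_series br n = {0}" for n
  proof -
    have "?br X Y = 0" if "X \<in> derived_series ?br n" "Y \<in> derived_series ?br n" for X Y
    proof -
      have "fst X = 0" "fst Y = 0"
        using that fst_image[of n] \<open>derived_series br n = {0}\<close> by blast+
      thus ?thesis
        using linear_0[OF lie_representation_onD(2)[OF \<alpha>]] lie_algebra.br_self[OF assms(1)]
        by (cases X; cases Y) (simp add: zero_prod_def)
    qed
    hence "{?br X Y |X Y. X \<in> derived_series ?br n \<and> Y \<in> derived_series ?br n} \<subseteq> {0}"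
      by blast
    from span_mono[OF this] show ?thesis
      by (auto simp: brackets_def span_zero)
  qed
  moreover have "derived_series br n = {0}" if "derived_series ?br n = {0}" for n
    using fst_image[of n] that by simp
  ultimately show ?thesis unfolding lie_solvable_def by blast
qed

section \<open>Traces and unimodularity\<close>

lemma trace_form_semidirect_bracket:
  assumes \<alpha>: "lie_representation_on br UNIV \<alpha>"
  shows "trace_form (semidirect_bracket br \<alpha>) (x, v) = trace_form br x + endo_trace (\<alpha> x)"
proof -
  let ?F = "\<lambda>b. semidirect_bracket br \<alpha> (x, v) b \<bullet> b"
  \<comment> \<open>The adjoint map is block triangular: the block \<open>- \<alpha> b v\<close>
    sends the first factor into the second and is invisible on the diagonal.\<close>
  have "(\<Sum>b\<in>Basis. ?F b) = (\<Sum>b\<in>Basis. ?F (b, 0)) + (\<Sum>b\<in>Basis. ?F (0, b))"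
    unfolding Basis_prod_def
    by (subst sum.union_disjoint) (auto simp: sum.reindex inj_on_def)
  thus ?thesis
    using linear_0[OF lie_representation_onD(1)[OF \<alpha>]]
      linear_0[OF lie_representation_onD(2)[OF \<alpha>]]
    by (simp add: trace_form_def endo_trace_def)
qed

lemma endo_trace_twisted_rep:
  fixes \<beta> :: "'a \<Rightarrow> 'b::euclidean_space \<Rightarrow> 'b"
  assumes "\<beta> x \<in> so_endo (\<bullet>)"
  shows "endo_trace (twisted_rep \<xi> \<beta> x) = real DIM('b) * \<xi> x"
proof -
  \<comment> \<open>A diagonal entry of a skew map equals its own negative, so only the scalar part
    contributes to the trace.\<close>
  have "\<beta> x b \<bullet> b = - (b \<bullet> \<beta> x b)" for b
    using assms by (simp add: so_endo_def)
  hence "\<beta> x b \<bullet> b = 0" for b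
    by (simp add: inner_commute)
  thus ?thesis
    by (simp add: endo_trace_def twisted_rep_def inner_add_left)
qed

theorem proposition4p11:
  fixes br_h :: "'h::euclidean_space \<Rightarrow> 'h \<Rightarrow> 'h"
    and h :: "'h \<Rightarrow> 'h \<Rightarrow> real"
    and \<xi> :: "'h \<Rightarrow> real"
    and \<beta> :: "'h \<Rightarrow> real ^ 'q \<Rightarrow> real ^ 'q"
    and \<alpha> :: "'h \<Rightarrow> real ^ 'q \<Rightarrow> real ^ 'q"
    and br_g :: "'h \<times> (real ^ 'q) \<Rightarrow> 'h \<times> (real ^ 'q) \<Rightarrow> 'h \<times> (real ^ 'q)"
    and g :: "'h \<times> (real ^ 'q) \<Rightarrow> 'h \<times> (real ^ 'q) \<Rightarrow> real"
    and \<theta> :: "'h \<times> (real ^ 'q) \<Rightarrow> real"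
    and u :: "('h \<times> (real ^ 'q)) set"
  assumes "lie_algebra br_h"
    and "inner_product h"
    and "closed_form br_h \<xi>" and "\<xi> \<noteq> (\<lambda>x. 0)"
    and "lie_representation_on br_h UNIV \<beta>" and "\<forall>x. \<beta> x \<in> so_endo (\<bullet>)"
    and "\<alpha> = twisted_rep \<xi> \<beta>"
    and "br_g = semidirect_bracket br_h \<alpha>"
    and "g = orthogonal_sum h (\<bullet>)"
    and "\<theta> = extend_by_zero \<xi>"
    and "u = {0} \<times> UNIV"
  shows "adapted_lcp_structure br_g g \<theta> u \<and>
         (lie_solvable br_g \<longleftrightarrow> lie_solvable br_h) \<and>
         (unimodular br_g \<longleftrightarrow> \<xi> = (\<lambda>x. - (1 / real CARD('q)) * trace_form br_h x))"
proof -
  note br_h = assms(1) and h = assms(2) and \<xi> = assms(3) and \<beta> = assms(5)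
  have so: "\<beta> x \<in> so_endo (\<bullet>)" for x using assms(6) by blast
  have \<alpha>: "lie_representation_on br_h UNIV \<alpha>"
    unfolding assms(7) by (rule lie_representation_twisted_rep[OF \<xi> \<beta>])
  have "\<theta> \<noteq> (\<lambda>X. 0)"
  proof
    assume "\<theta> = (\<lambda>X. 0)"
    hence "\<xi> x = 0" for x
      using extend_by_zero_simp[of \<xi> x "0 :: real ^ 'q"] by (simp add: assms(10))
    thus False using assms(4) by blast
  qed
  moreover have "flat_subspace br_g g \<theta> u"
    unfolding assms(7-) by (rule flat_subspace_semidirect[OF br_h h \<xi> \<beta> so])
  moreover have "u \<noteq> {0}"
  proof -
    \<comment> \<open>Here \<open>1\<close> is the all-ones vector; it is nonzero because the index
      type \<open>'q\<close> is nonempty, which encodes q >= 1.\<close>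
    have "(0, 1) \<in> u" "(0, 1 :: real ^ 'q) \<noteq> (0 :: 'h \<times> (real ^ 'q))"
      by (simp_all add: assms(11) zero_prod_def)
    thus ?thesis by blast
  qed
  moreover have "lie_algebra br_g" "inner_product g" "closed_form br_g \<theta>"
    unfolding assms(8-10)
    by (rule lie_algebra_semidirect_bracket[OF br_h \<alpha>]
        inner_product_orthogonal_sum[OF h inner_product_inner]
        closed_form_extend_by_zero[OF \<xi>])+
  ultimately have "lcp_structure br_g g \<theta> u"
    by (simp add: lcp_structure_def)
  moreover have "\<forall>X\<in>u. \<theta> X = 0"
    using \<xi> by (auto simp: assms(10,11) closed_form_def linear_0)
  moreover have "lie_solvable br_g \<longleftrightarrow> lie_solvable br_h"
    unfolding assms(8) by (rule lie_solvable_semidirect_bracket[OF br_h \<alpha>])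
  moreover have "unimodular br_g \<longleftrightarrow> \<xi> = (\<lambda>x. - (1 / real CARD('q)) * trace_form br_h x)"
  proof -
    have "trace_form br_g (x, v) = trace_form br_h x + real CARD('q) * \<xi> x" for x v
      unfolding assms(8) trace_form_semidirect_bracket[OF \<alpha>]
      by (simp add: assms(7) endo_trace_twisted_rep[OF so])
    hence "unimodular br_g \<longleftrightarrow> (\<forall>x. trace_form br_h x + real CARD('q) * \<xi> x = 0)"
      by (simp add: unimodular_def fun_eq_iff)
    \<comment> \<open>Solving for \<open>\<xi> x\<close> divides by \<open>CARD('q)\<close>, which
      is positive for a finite type.\<close>
    also have "\<dots> \<longleftrightarrow> (\<forall>x. \<xi> x = - (1 / real CARD('q)) * trace_form br_h x)"
      by (intro all_cong1) (auto simp: field_simps)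
    finally show ?thesis by (simp add: fun_eq_iff)
  qed
  ultimately show ?thesis by (simp add: adapted_lcp_structure_def)
qed

end
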